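(* If $\mathcal{D}$ is a non-ascending deformation space of $G$-trees, all reduced trees in $\mathcal{D}$ have the same vertex and edge stabilizers; given two reduced trees in $\mathcal{D}$, there are $G$-equivariant bijections $\psi_V$, $\psi_E$ between their vertex sets and between their edge sets, respectively.
   Context: $G$ is a finitely generated group. A $G$-tree is a simplicial tree $T$ with an action of $G$ by simplicial automorphisms without inversions, always assumed minimal (no proper $G$-invariant subtree). $G_v,G_e$ denote vertex and edge stabilizers. A subgroup of $G$ is elliptic in $T$ if it fixes a point. The deformation space $\mathcal{D}$ of a $G$-tree is the set of $G$-trees having the same elliptic subgroups (edge lengths are ignored here). $\mathcal{D}$ is irreducible if in its trees there are two hyperbolic (non-elliptic) elements with disjoint translation axes. $T$ is reduced if whenever an edge $e=vw$ satisfies $G_e=G_v$, the vertices $v$ and $w$ are in the same $G$-orbit. View $\Gamma=T/G$ as a graph of groups. A strict ascending loop is an edge of $\Gamma$ with equal endpoints such that exactly one of the two inclusions of its edge group into the vertex group is onto. $\mathcal{D}$ is non-ascending if it is irreducible and no $\Gamma=T/G$ with $T\in\mathcal{D}$ contains a strict ascending loop. *)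

theory Defs
  imports "HOL-Algebra.Group_Action" "HOL-Algebra.Generated_Groups"
begin

definition finitely_generated :: "('g, 'm) monoid_scheme \<Rightarrow> bool" where
  "finitely_generated G \<longleftrightarrow>
     (\<exists>S. finite S \<and> S \<subseteq> carrier G \<and> generate G S = carrier G)"

subsection \<open>Simplicial trees\<close>

text \<open>
  A simplicial tree is given by its set of vertices and its set of (unoriented) edges, an edge
  being the two-element set of its endpoints: a tree has no loops and no multiple edges.
\<close>

definition simple_cycle :: "'v set set \<Rightarrow> 'v list \<Rightarrow> bool" where
  "simple_cycle E xs \<longleftrightarrow>
     length xs \<ge> 3 \<and> distinct xs \<and> successively (\<lambda>x y. {x, y} \<in> E) xs \<and> {last xs, hd xs} \<in> E"

definition is_tree :: "'v set \<Rightarrow> 'v set set \<Rightarrow> bool" where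
  "is_tree V E \<longleftrightarrow>
     V \<noteq> {} \<and>
     (\<forall>e\<in>E. \<exists>v\<in>V. \<exists>w\<in>V. v \<noteq> w \<and> e = {v, w}) \<and>
     (\<forall>v\<in>V. \<forall>w\<in>V. (v, w) \<in> {(x, y). {x, y} \<in> E}\<^sup>*) \<and>
     \<not> (\<exists>xs. simple_cycle E xs)"

subsection \<open>G-trees\<close>

record ('g, 'v) gtree =
  verts :: "'v set"
  edges :: "'v set set"
  act :: "'g \<Rightarrow> 'v \<Rightarrow> 'v"

definition edge_act :: "('g, 'v) gtree \<Rightarrow> 'g \<Rightarrow> 'v set \<Rightarrow> 'v set" where
  "edge_act T g e = act T g ` e"

definition invariant_subtree ::
    "('g, 'm) monoid_scheme \<Rightarrow> ('g, 'v) gtree \<Rightarrow> 'v set \<Rightarrow> 'v set set \<Rightarrow> bool" where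
  "invariant_subtree G T W F \<longleftrightarrow>
     W \<subseteq> verts T \<and> F \<subseteq> edges T \<and> is_tree W F \<and>
     (\<forall>g\<in>carrier G. (\<forall>v\<in>W. act T g v \<in> W) \<and> (\<forall>e\<in>F. edge_act T g e \<in> F))"

definition G_tree :: "('g, 'm) monoid_scheme \<Rightarrow> ('g, 'v) gtree \<Rightarrow> bool" where
  "G_tree G T \<longleftrightarrow>
     is_tree (verts T) (edges T) \<and>
     group_action G (verts T) (act T) \<and>
     (\<forall>g\<in>carrier G. \<forall>e\<in>edges T. edge_act T g e \<in> edges T) \<and>
     (\<forall>g\<in>carrier G. \<forall>v w. {v, w} \<in> edges T \<longrightarrow> \<not> (act T g v = w \<and> act T g w = v)) \<and>
     (\<forall>W F. invariant_subtree G T W F \<longrightarrow> W = verts T \<and> F = edges T)"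

text \<open>
  As there are no inversions, the setwise stabilizer of an edge is also its pointwise stabilizer.
\<close>

definition vstab :: "('g, 'm) monoid_scheme \<Rightarrow> ('g, 'v) gtree \<Rightarrow> 'v \<Rightarrow> 'g set" where
  "vstab G T v = stabilizer G (act T) v"

definition estab :: "('g, 'm) monoid_scheme \<Rightarrow> ('g, 'v) gtree \<Rightarrow> 'v set \<Rightarrow> 'g set" where
  "estab G T e = stabilizer G (edge_act T) e"

text \<open>
  A subgroup fixing a point in the interior of an edge fixes both endpoints of that edge (there
  are no inversions), so that fixing a point of the tree means fixing a vertex.
\<close>

definition elliptic_subgroups :: "('g, 'm) monoid_scheme \<Rightarrow> ('g, 'v) gtree \<Rightarrow> 'g set set" where
  "elliptic_subgroups G T =
     {H. subgroup H G \<and> (\<exists>v\<in>verts T. \<forall>h\<in>H. act T h v = v)}"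

definition hyperbolic :: "('g, 'm) monoid_scheme \<Rightarrow> ('g, 'v) gtree \<Rightarrow> 'g \<Rightarrow> bool" where
  "hyperbolic G T g \<longleftrightarrow> g \<in> carrier G \<and> \<not> (\<exists>v\<in>verts T. act T g v = v)"

text \<open>\<open>A\<close> is the vertex set of a line along which \<open>g\<close> acts as a non-trivial translation.\<close>

definition translation_axis :: "('g, 'v) gtree \<Rightarrow> 'g \<Rightarrow> 'v set \<Rightarrow> bool" where
  "translation_axis T g A \<longleftrightarrow>
     (\<exists>p :: int \<Rightarrow> 'v. inj p \<and> range p = A \<and> (\<forall>i. {p i, p (i + 1)} \<in> edges T) \<and>
        (\<exists>l. l \<noteq> 0 \<and> (\<forall>i. act T g (p i) = p (i + l))))"

definition reduced :: "('g, 'm) monoid_scheme \<Rightarrow> ('g, 'v) gtree \<Rightarrow> bool" where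
  "reduced G T \<longleftrightarrow>
     (\<forall>v w. {v, w} \<in> edges T \<longrightarrow> estab G T {v, w} = vstab G T v \<longrightarrow>
        orbit G (act T) v = orbit G (act T) w)"

subsection \<open>The quotient graph of groups\<close>

text \<open>
  Vertices and edges of the quotient are orbits. The vertex and edge groups are the stabilizers of
  chosen lifts. If \<open>v\<close> is an endpoint of the chosen lift \<open>e\<close> of an edge, the inclusion of the edge
  group at the corresponding end is the inclusion of the stabilizer of \<open>e\<close> into that of \<open>v\<close>,
  followed by conjugation by an element carrying \<open>v\<close> to the chosen lift of its orbit. The ends of
  an edge of the quotient are thus indexed by the endpoints of its chosen lift, also for a loop.
\<close>

definition quotient_edges ::
    "('g, 'm) monoid_scheme \<Rightarrow> ('g, 'v) gtree \<Rightarrow> 'v set set set" where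
  "quotient_edges G T = orbits G (edges T) (edge_act T)"

definition lift :: "'a set \<Rightarrow> 'a" where
  "lift x = (SOME v. v \<in> x)"

definition vertex_group :: "('g, 'm) monoid_scheme \<Rightarrow> ('g, 'v) gtree \<Rightarrow> 'v set \<Rightarrow> 'g set" where
  "vertex_group G T x = vstab G T (lift x)"

definition edge_group :: "('g, 'm) monoid_scheme \<Rightarrow> ('g, 'v) gtree \<Rightarrow> 'v set set \<Rightarrow> 'g set" where
  "edge_group G T y = estab G T (lift y)"

definition transporter :: "('g, 'm) monoid_scheme \<Rightarrow> ('g, 'v) gtree \<Rightarrow> 'v \<Rightarrow> 'g" where
  "transporter G T v = (SOME g. g \<in> carrier G \<and> act T g v = lift (orbit G (act T) v))"

definition edge_inclusion ::
    "('g, 'm) monoid_scheme \<Rightarrow> ('g, 'v) gtree \<Rightarrow> 'v \<Rightarrow> 'g \<Rightarrow> 'g" where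
  "edge_inclusion G T v h =
     transporter G T v \<otimes>\<^bsub>G\<^esub> h \<otimes>\<^bsub>G\<^esub> inv\<^bsub>G\<^esub> (transporter G T v)"

definition inclusion_onto ::
    "('g, 'm) monoid_scheme \<Rightarrow> ('g, 'v) gtree \<Rightarrow> 'v set set \<Rightarrow> 'v \<Rightarrow> bool" where
  "inclusion_onto G T y v \<longleftrightarrow>
     edge_inclusion G T v ` edge_group G T y = vertex_group G T (orbit G (act T) v)"

definition strict_ascending_loop ::
    "('g, 'm) monoid_scheme \<Rightarrow> ('g, 'v) gtree \<Rightarrow> 'v set set \<Rightarrow> bool" where
  "strict_ascending_loop G T y \<longleftrightarrow>
     y \<in> quotient_edges G T \<and>
     (\<exists>v w. lift y = {v, w} \<and> orbit G (act T) v = orbit G (act T) w \<and>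
        inclusion_onto G T y v \<noteq> inclusion_onto G T y w)"

subsection \<open>Deformation spaces\<close>

text \<open>
  All trees of a deformation space have their vertices in one fixed type \<open>'v\<close>. For finitely
  generated \<open>G\<close> this loses no tree as soon as \<open>'v\<close> is infinite: a minimal \<open>G\<close>-tree then has
  countably many vertices, hence an isomorphic copy on \<open>'v\<close>. If \<open>'v\<close> is finite, no deformation
  space over \<open>'v\<close> is irreducible.
\<close>

definition deformation_space_of ::
    "('g, 'm) monoid_scheme \<Rightarrow> ('g, 'v) gtree \<Rightarrow> ('g, 'v) gtree set" where
  "deformation_space_of G T = {T'. G_tree G T' \<and> elliptic_subgroups G T' = elliptic_subgroups G T}"

definition deformation_space ::
    "('g, 'm) monoid_scheme \<Rightarrow> ('g, 'v) gtree set \<Rightarrow> bool" where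
  "deformation_space G D \<longleftrightarrow> (\<exists>T. G_tree G T \<and> D = deformation_space_of G T)"

definition irreducible_space ::
    "('g, 'm) monoid_scheme \<Rightarrow> ('g, 'v) gtree set \<Rightarrow> bool" where
  "irreducible_space G D \<longleftrightarrow>
     (\<forall>T\<in>D. \<exists>g h A B. hyperbolic G T g \<and> hyperbolic G T h \<and>
        translation_axis T g A \<and> translation_axis T h B \<and> A \<inter> B = {})"

definition non_ascending ::
    "('g, 'm) monoid_scheme \<Rightarrow> ('g, 'v) gtree set \<Rightarrow> bool" where
  "non_ascending G D \<longleftrightarrow>
     irreducible_space G D \<and> (\<forall>T\<in>D. \<not> (\<exists>y. strict_ascending_loop G T y))"

definition equivariant_bijection ::
    "('g, 'm) monoid_scheme \<Rightarrow> 'a set \<Rightarrow> ('g \<Rightarrow> 'a \<Rightarrow> 'a) \<Rightarrow> 'b set \<Rightarrow> ('g \<Rightarrow> 'b \<Rightarrow> 'b) \<Rightarrow>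
     ('a \<Rightarrow> 'b) \<Rightarrow> bool" where
  "equivariant_bijection G X a Y b f \<longleftrightarrow>
     bij_betw f X Y \<and> (\<forall>g\<in>carrier G. \<forall>x\<in>X. f (a g x) = b g (f x))"

end

theory Submission
  imports Defs
begin

text \<open>
  In a reduced tree without strict ascending loops the vertex stabilizers are exactly the maximal
  elliptic subgroups, and vertices with the same stabilizer lie in one orbit. Hence the vertices, as
  a set with an action of \<open>G\<close>, are determined by the elliptic subgroups.

  For the edges, fix a subgroup \<open>K\<close>. The functions \<open>c\<close> with values in \<open>\<int>/2\<close> on pairs of vertices
  fixed by \<open>K\<close> that satisfy \<open>c(p,r) = c(p,q) + c(q,r)\<close>, are invariant under the normalizer of \<open>K\<close>
  and vanish whenever the common stabilizer of \<open>p\<close> and \<open>q\<close> is larger than \<open>K\<close> depend only on the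
  set of vertices with its action. On the other hand such a function is determined by its values on
  the edges with stabilizer \<open>K\<close>, and these can be prescribed freely on each orbit of edges.
  So two such trees have the same number of orbits of edges with stabilizer conjugate to \<open>K\<close>; this
  number is finite because \<open>G\<close> is finitely generated and acts minimally.
\<close>

section \<open>Sets with a group action\<close>

text \<open>
  The locale \<open>group_action\<close> of the library requires each group element to act extensionally, which
  fails for the action on edges by direct images.
\<close>

locale gset = group G for G :: "('g, 'm) monoid_scheme" (structure) +
  fixes X :: "'x set" and a :: "'g \<Rightarrow> 'x \<Rightarrow> 'x"
  assumes closed: "g \<in> carrier G \<Longrightarrow> x \<in> X \<Longrightarrow> a g x \<in> X"
    and act_one: "x \<in> X \<Longrightarrow> a \<one> x = x"
    and act_mult: "g \<in> carrier G \<Longrightarrow> h \<in> carrier G \<Longrightarrow> x \<in> X \<Longrightarrow> a (g \<otimes> h) x = a g (a h x)"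
begin

lemma act_inv [simp]: "g \<in> carrier G \<Longrightarrow> x \<in> X \<Longrightarrow> a (inv g) (a g x) = x"
  by (metis act_mult act_one inv_closed l_inv)

lemma act_inv' [simp]: "g \<in> carrier G \<Longrightarrow> x \<in> X \<Longrightarrow> a g (a (inv g) x) = x"
  using act_inv[of "inv g" x] by simp

lemma act_inj: "g \<in> carrier G \<Longrightarrow> x \<in> X \<Longrightarrow> y \<in> X \<Longrightarrow> a g x = a g y \<longleftrightarrow> x = y"
  by (metis act_inv)

lemma act_eq_iff:
  assumes "g \<in> carrier G" "h \<in> carrier G" "x \<in> X"
  shows "a g x = a h x \<longleftrightarrow> inv g \<otimes> h \<in> stabilizer G a x"
proof -
  have "a g x = a h x \<longleftrightarrow> a (inv g) (a g x) = a (inv g) (a h x)"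
    using assms by (metis act_inv' closed)
  then show ?thesis
    using assms by (auto simp: stabilizer_def act_mult)
qed

lemma stabilizer_act_iff:
  assumes "g \<in> carrier G" "x \<in> X"
  shows "h \<in> stabilizer G a (a g x) \<longleftrightarrow> h \<in> carrier G \<and> inv g \<otimes> h \<otimes> g \<in> stabilizer G a x"
proof (cases "h \<in> carrier G")
  case True
  have "a h (a g x) = a g x \<longleftrightarrow> a g x = a (h \<otimes> g) x"
    using assms True by (auto simp: act_mult)
  also have "\<dots> \<longleftrightarrow> inv g \<otimes> (h \<otimes> g) \<in> stabilizer G a x"
    using assms True by (simp add: act_eq_iff)
  finally show ?thesis
    using assms True by (simp add: stabilizer_def m_assoc)
qed (simp add: stabilizer_def)

lemma orbit_self: "x \<in> X \<Longrightarrow> x \<in> orbit G a x"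
  using act_one[of x] by (force simp: orbit_def)

lemma orbit_act:
  assumes g: "g \<in> carrier G" and x: "x \<in> X"
  shows "orbit G a (a g x) = orbit G a x"
proof -
  have "a h x \<in> orbit G a (a g x)" if "h \<in> carrier G" for h
    using that g x by (auto simp: orbit_def intro!: exI[of _ "h \<otimes> inv g"] simp: act_mult closed)
  moreover have "a h (a g x) \<in> orbit G a x" if "h \<in> carrier G" for h
    using that g x by (auto simp: orbit_def intro!: exI[of _ "h \<otimes> g"] simp: act_mult)
  ultimately show ?thesis by (auto simp: orbit_def)
qed

lemma orbit_eq_iff:
  assumes "x \<in> X" "y \<in> X"
  shows "orbit G a x = orbit G a y \<longleftrightarrow> (\<exists>g\<in>carrier G. y = a g x)"
proof
  assume "orbit G a x = orbit G a y"
  then have "y \<in> orbit G a x" using orbit_self assms by simp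
  then show "\<exists>g\<in>carrier G. y = a g x" by (auto simp: orbit_def)
qed (use orbit_act assms in metis)

lemma orbits_iff: "oo \<in> orbits G X a \<longleftrightarrow> (\<exists>x\<in>X. oo = orbit G a x)"
  by (auto simp: orbits_def)

lemma in_orbits_eq:
  assumes "oo \<in> orbits G X a" "x \<in> oo"
  shows "x \<in> X \<and> oo = orbit G a x"
proof -
  from assms obtain y g where "y \<in> X" "oo = orbit G a y" "g \<in> carrier G" "x = a g y"
    by (auto simp: orbits_def orbit_def[of G a])
  then show ?thesis using orbit_act closed by metis
qed

end

text \<open>In either set, moving a point by \<open>g\<close> conjugates its stabilizer by
  \<open>g\<close>. The converse direction is the direct one applied to the inverse of
  \<open>g\<close>.\<close>

lemma stabilizer_eq_act_iff:
  assumes "gset G X a" "gset G Y b" "g \<in> carrier G" "x \<in> X" "y \<in> Y"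
  shows "stabilizer G a (a g x) = stabilizer G b (b g y) \<longleftrightarrow> stabilizer G a x = stabilizer G b y"
proof -
  have *: "stabilizer G a (a g x) = stabilizer G b (b g y)"
    if "gset G X a" "gset G Y b" "g \<in> carrier G" "x \<in> X" "y \<in> Y"
      "stabilizer G a x = stabilizer G b y" for g x y
    using that by (auto simp: gset.stabilizer_act_iff)
  interpret A: gset G X a by fact
  interpret B: gset G Y b by fact
  show ?thesis
    using *[of g x y] *[of "inv\<^bsub>G\<^esub> g" "a g x" "b g y"] assms
    by (auto simp: A.closed B.closed)
qed

text \<open>The stabilizers along an orbit form a full conjugacy class of subgroups, and two
  conjugacy classes with a common member coincide.\<close>

lemma stabilizer_image_orbit_eq:
  assumes "gset G X a" "gset G Y b" "oo \<in> orbits G X a" "oo' \<in> orbits G Y b"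
    and "K \<in> stabilizer G a ` oo" "K \<in> stabilizer G b ` oo'"
  shows "stabilizer G a ` oo = stabilizer G b ` oo'"
proof -
  interpret A: gset G X a by fact
  interpret B: gset G Y b by fact
  obtain x y where x: "x \<in> oo" "K = stabilizer G a x" and y: "y \<in> oo'" "K = stabilizer G b y"
    using assms by auto
  have oo: "x \<in> X" "oo = {a g x |g. g \<in> carrier G}"
    using A.in_orbits_eq[OF assms(3) x(1)] by (auto simp: orbit_def)
  have oo': "y \<in> Y" "oo' = {b g y |g. g \<in> carrier G}"
    using B.in_orbits_eq[OF assms(4) y(1)] by (auto simp: orbit_def)
  have "stabilizer G a (a g x) = stabilizer G b (b g y)" if "g \<in> carrier G" for g
    using stabilizer_eq_act_iff[OF assms(1,2) that oo(1) oo'(1)] x y by simp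
  then show ?thesis unfolding oo(2) oo'(2) by (auto simp: image_iff)
qed

text \<open>An orbit is determined up to isomorphism by the conjugacy class of its stabilizers.
  Orbits of equal class are matched, base points with equal stabilizers are chosen in matched
  orbits, and the map is extended by equivariance.\<close>

lemma equivariant_bijection_of_orbits:
  fixes G :: "('g, 'm) monoid_scheme"
  assumes X: "gset G X a" and Y: "gset G Y b"
    and K: "\<And>K. \<exists>\<beta>. bij_betw \<beta> {oo \<in> orbits G X a. K \<in> stabilizer G a ` oo}
                               {oo \<in> orbits G Y b. K \<in> stabilizer G b ` oo}"
  shows "\<exists>f. equivariant_bijection G X a Y b f"
proof -
  interpret A: gset G X a by fact
  interpret B: gset G Y b by fact
  let ?s = "stabilizer G a" and ?t = "stabilizer G b"
  let ?U = "\<lambda>k. {oo \<in> orbits G X a. ?s ` oo = k}" and ?V = "\<lambda>k. {oo \<in> orbits G Y b. ?t ` oo = k}"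
  \<comment> \<open>Different subgroups \<open>K\<close> may describe the same family of orbits.
    Indexing by the whole conjugacy class \<open>k\<close> makes the families disjoint, so that
    their bijections can be glued. Any \<open>L\<close> in \<open>k\<close> recovers the family of
    \<open>k\<close> from the assumption.\<close>
  have "\<exists>\<beta>. bij_betw \<beta> (?U k) (?V k)" for k
  proof (cases "?U k = {} \<and> ?V k = {}")
    case True
    then show ?thesis by (metis bij_betw_def image_empty inj_on_empty)
  next
    case False
    then have "k \<noteq> {}" using A.in_orbits_eq A.orbit_self A.orbits_iff B.orbit_self B.orbits_iff
      by (smt (verit) empty_Collect_eq image_is_empty empty_iff)
    then obtain L where L: "L \<in> k" by auto
    consider o1 where "o1 \<in> orbits G X a" "?s ` o1 = k" | o2 where "o2 \<in> orbits G Y b" "?t ` o2 = k"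
      using False by blast
    then have "(\<forall>oo\<in>orbits G X a. L \<in> ?s ` oo \<longrightarrow> ?s ` oo = k) \<and>
        (\<forall>oo\<in>orbits G Y b. L \<in> ?t ` oo \<longrightarrow> ?t ` oo = k)"
    proof cases
      case 1
      then show ?thesis
        using stabilizer_image_orbit_eq[OF X X _ 1(1)] stabilizer_image_orbit_eq[OF Y X _ 1(1)] L by metis
    next
      case 2
      then show ?thesis
        using stabilizer_image_orbit_eq[OF X Y _ 2(1)] stabilizer_image_orbit_eq[OF Y Y _ 2(1)] L by metis
    qed
    then have "?U k = {oo \<in> orbits G X a. L \<in> ?s ` oo}" "?V k = {oo \<in> orbits G Y b. L \<in> ?t ` oo}"
      using L by metis+
    then show ?thesis using K[of L] by simp
  qed
  then have "\<forall>k. \<exists>\<beta>. bij_betw \<beta> (?U k) (?V k)" by blast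
  from choice[OF this] obtain \<beta> where \<beta>: "\<And>k. bij_betw (\<beta> k) (?U k) (?V k)" by blast
  \<comment> \<open>Each orbit is sent on by the bijection belonging to its own class. As
    \<open>B\<close> preserves the class, injectivity and surjectivity can be checked class by
    class.\<close>
  define B where "B oo = \<beta> (?s ` oo) oo" for oo
  have B: "B oo \<in> orbits G Y b" "?t ` B oo = ?s ` oo" if "oo \<in> orbits G X a" for oo
    using bij_betwE[OF \<beta>[of "?s ` oo"]] that by (auto simp: B_def)
  have B_inj: "oo = oo'" if "oo \<in> orbits G X a" "oo' \<in> orbits G X a" "B oo = B oo'" for oo oo'
    using \<beta>[of "?s ` oo"] B[OF that(1)] B[OF that(2)] that
    by (auto simp: bij_betw_def inj_on_def B_def)
  have B_surj: "\<exists>oo\<in>orbits G X a. B oo = oo'" if "oo' \<in> orbits G Y b" for oo'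
  proof -
    have "oo' \<in> \<beta> (?t ` oo') ` ?U (?t ` oo')" using \<beta>[of "?t ` oo'"] that by (simp add: bij_betw_def)
    then obtain oo where "oo \<in> orbits G X a" "?s ` oo = ?t ` oo'" "oo' = \<beta> (?t ` oo') oo" by blast
    then show ?thesis unfolding B_def by metis
  qed
  have "\<exists>r s. r \<in> oo \<and> s \<in> B oo \<and> ?s r = ?t s" if "oo \<in> orbits G X a" for oo
  proof -
    obtain r where "r \<in> oo" using \<open>oo \<in> _\<close> A.orbit_self by (auto simp: A.orbits_iff)
    then have "?s r \<in> ?t ` B oo" using B(2)[OF that] by blast
    with \<open>r \<in> oo\<close> show ?thesis by auto
  qed
  then obtain r s where rs: "\<And>oo. oo \<in> orbits G X a \<Longrightarrow> r oo \<in> oo \<and> s oo \<in> B oo \<and> ?s (r oo) = ?t (s oo)"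
    by metis
  have r: "r oo \<in> X" "oo = orbit G a (r oo)" if "oo \<in> orbits G X a" for oo
    using A.in_orbits_eq that rs by blast+
  have s: "s oo \<in> Y" "B oo = orbit G b (s oo)" if "oo \<in> orbits G X a" for oo
    using B.in_orbits_eq that rs B(1) by blast+
  \<comment> \<open>The choice of \<open>g\<close> is immaterial: \<open>r oo\<close> and
    \<open>s oo\<close> have the same stabilizer, so two elements agree on one exactly when they
    agree on the other.\<close>
  define f where "f x = (let oo = orbit G a x in b (SOME g. g \<in> carrier G \<and> a g (r oo) = x) (s oo))" for x
  have eq: "a g (r oo) = a h (r oo) \<longleftrightarrow> b g (s oo) = b h (s oo)"
    if "oo \<in> orbits G X a" "g \<in> carrier G" "h \<in> carrier G" for g h oo
    using that r s rs by (simp add: A.act_eq_iff B.act_eq_iff)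
  have f: "f (a g (r oo)) = b g (s oo)" if "oo \<in> orbits G X a" "g \<in> carrier G" for g oo
  proof -
    have 1: "orbit G a (a g (r oo)) = oo" using that r A.orbit_act by metis
    define h where "h = (SOME h. h \<in> carrier G \<and> a h (r oo) = a g (r oo))"
    have "h \<in> carrier G \<and> a h (r oo) = a g (r oo)"
      unfolding h_def by (rule someI[of _ g]) (use that in simp)
    then have "b h (s oo) = b g (s oo)" using eq[OF that(1) _ that(2)] by blast
    then show ?thesis by (simp add: f_def 1 h_def)
  qed
  have X_cases: "\<exists>oo g. oo \<in> orbits G X a \<and> g \<in> carrier G \<and> x = a g (r oo)" if "x \<in> X" for x
  proof -
    have oo: "orbit G a x \<in> orbits G X a" using that by (auto simp: A.orbits_iff)
    show ?thesis using r[OF oo] that A.orbit_eq_iff[of "r (orbit G a x)" x] oo by metis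
  qed
  have "bij_betw f X Y"
    unfolding bij_betw_def
  proof
    show "inj_on f X"
    proof (rule inj_onI)
      fix x y assume "x \<in> X" "y \<in> X" and fxy: "f x = f y"
      then obtain o1 g o2 h where *: "o1 \<in> orbits G X a" "g \<in> carrier G" "x = a g (r o1)"
        "o2 \<in> orbits G X a" "h \<in> carrier G" "y = a h (r o2)" using X_cases by metis
      have "b g (s o1) = b h (s o2)" using fxy * f by metis
      then have "B o1 = B o2" using B.orbit_act s * by metis
      then have "o1 = o2" using B_inj * by blast
      then show "x = y" using eq * \<open>b g (s o1) = b h (s o2)\<close> by simp
    qed
    have "y \<in> f ` X" if y: "y \<in> Y" for y
    proof -
      have "orbit G b y \<in> orbits G Y b" using y by (auto simp: B.orbits_iff)
      then obtain oo where oo: "oo \<in> orbits G X a" "B oo = orbit G b y" using B_surj by metis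
      then obtain g where g: "g \<in> carrier G" "y = b g (s oo)"
        using s[OF oo(1)] y B.orbit_eq_iff by metis
      then have "y = f (a g (r oo))" using f oo by simp
      then show ?thesis using A.closed g r oo by blast
    qed
    moreover have "f x \<in> Y" if "x \<in> X" for x
      using X_cases[OF that] f s B.closed by force
    ultimately show "f ` X = Y" by blast
  qed
  moreover have "f (a g x) = b g (f x)" if g: "g \<in> carrier G" and x: "x \<in> X" for g x
  proof -
    obtain oo h where *: "oo \<in> orbits G X a" "h \<in> carrier G" "x = a h (r oo)"
      using X_cases x by metis
    have "f (a g x) = f (a (g \<otimes>\<^bsub>G\<^esub> h) (r oo))" using * g r by (simp add: A.act_mult)
    also have "\<dots> = b g (f x)" using * g s by (simp add: f B.act_mult)
    finally show ?thesis .
  qed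
  ultimately show ?thesis by (auto simp: equivariant_bijection_def)
qed

lemma equivariant_bijection_stabilizer:
  assumes X: "gset G X a" and Y: "gset G Y b" and f: "equivariant_bijection G X a Y b f" and x: "x \<in> X"
  shows "stabilizer G b (f x) = stabilizer G a x"
proof -
  interpret A: gset G X a by fact
  have "b g (f x) = f x \<longleftrightarrow> a g x = x" if "g \<in> carrier G" for g
    using f x that A.closed by (auto simp: equivariant_bijection_def bij_betw_def inj_on_def) metis
  then show ?thesis by (auto simp: stabilizer_def)
qed

lemma equivariant_bijection_stabilizers:
  assumes "gset G X a" "gset G Y b" "equivariant_bijection G X a Y b f"
  shows "stabilizer G a ` X = stabilizer G b ` Y"
proof -
  have "Y = f ` X" using assms(3) by (simp add: equivariant_bijection_def bij_betw_def)
  then show ?thesis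
    using equivariant_bijection_stabilizer[OF assms] by (force simp: image_image)
qed

section \<open>Walks in trees\<close>

definition walk :: "'v set set \<Rightarrow> 'v \<Rightarrow> 'v list \<Rightarrow> 'v \<Rightarrow> bool" where
  "walk E p xs q \<longleftrightarrow> xs \<noteq> [] \<and> hd xs = p \<and> last xs = q \<and> successively (\<lambda>x y. {x, y} \<in> E) xs"

fun nonbacktracking :: "'v list \<Rightarrow> bool" where
  "nonbacktracking (x # y # z # r) \<longleftrightarrow> x \<noteq> z \<and> nonbacktracking (y # z # r)"
| "nonbacktracking _ \<longleftrightarrow> True"

text \<open>Truth values stand for the integers mod 2, with \<open>\<noteq>\<close> as addition;
  \<open>True\<close> means an odd number of crossings.\<close>

fun crossing_parity :: "'v set set \<Rightarrow> 'v list \<Rightarrow> bool" where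
  "crossing_parity A (x # y # r) \<longleftrightarrow> ({x, y} \<in> A) \<noteq> crossing_parity A (y # r)"
| "crossing_parity A _ \<longleftrightarrow> False"

text \<open>Backtracking is a condition on three consecutive vertices, so the two pieces must
  overlap in two vertices for no triple to be lost. For parities, a condition on pairs, one common
  vertex is enough.\<close>

lemma nonbacktracking_join:
  "nonbacktracking (xs @ y # z # ys) \<longleftrightarrow> nonbacktracking (xs @ [y, z]) \<and> nonbacktracking (y # z # ys)"
  by (induction xs rule: nonbacktracking.induct) auto

lemma nonbacktracking_rev: "nonbacktracking (rev xs) \<longleftrightarrow> nonbacktracking xs"
proof (induction xs rule: nonbacktracking.induct)
  case (1 x y z r)
  then show ?case using nonbacktracking_join[of "rev r" z y "[x]"] by auto
qed auto

lemma not_nonbacktracking_decomp: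
  "\<not> nonbacktracking xs \<longleftrightarrow> (\<exists>as x y cs. xs = as @ x # y # x # cs)"
proof
  show "\<not> nonbacktracking xs \<Longrightarrow> \<exists>as x y cs. xs = as @ x # y # x # cs"
  proof (induction xs rule: nonbacktracking.induct)
    case (1 x y z r)
    then show ?case by (metis append_Cons append_Nil nonbacktracking.simps(1))
  qed auto
  show "\<exists>as x y cs. xs = as @ x # y # x # cs \<Longrightarrow> \<not> nonbacktracking xs"
  proof (elim exE)
    fix as x y cs assume "xs = as @ x # y # x # cs"
    then show "\<not> nonbacktracking xs" using nonbacktracking_join[of as x y "x # cs"] by simp
  qed
qed

lemma nonbacktracking_map:
  "inj_on f (set xs) \<Longrightarrow> nonbacktracking (map f xs) \<longleftrightarrow> nonbacktracking xs"
proof (induction xs rule: nonbacktracking.induct)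
  case (1 x y z r)
  have "f x = f z \<longleftrightarrow> x = z" using inj_on_eq_iff[OF 1(2)] by simp
  moreover have "inj_on f (set (y # z # r))" using 1(2) by (rule inj_on_subset) auto
  ultimately show ?case using 1(1) by simp
qed auto

lemma crossing_parity_join:
  "crossing_parity A (xs @ y # ys) \<longleftrightarrow> crossing_parity A (xs @ [y]) \<noteq> crossing_parity A (y # ys)"
  by (induction A xs rule: crossing_parity.induct) auto

lemma walk_Cons: "walk E p (x # y # xs) q \<longleftrightarrow> p = x \<and> {x, y} \<in> E \<and> walk E y (y # xs) q"
  by (auto simp: walk_def)

lemma walk_Nil [simp]: "\<not> walk E p [] q"
  by (simp add: walk_def)

lemma walk_single: "walk E p [x] q \<longleftrightarrow> p = x \<and> q = x"
  by (auto simp: walk_def)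

lemma walk_join:
  "walk E p (xs @ y # ys) q \<longleftrightarrow> walk E p (xs @ [y]) y \<and> walk E y (y # ys) q"
  by (auto simp: walk_def successively_append_iff hd_append)

lemma walk_remove_backtrack: "walk E p (as @ x # y # x # cs) q \<Longrightarrow> walk E p (as @ x # cs) q"
  using walk_join[of E p as x "y # x # cs" q] walk_join[of E p as x cs q] by (auto simp: walk_Cons)

lemma walk_restrict: "walk E p xs q \<Longrightarrow> set xs \<subseteq> P \<Longrightarrow> walk {e \<in> E. e \<subseteq> P} p xs q"
  by (induction xs arbitrary: p rule: induct_list012) (auto simp: walk_Cons walk_single)

text \<open>A walk of least length cannot backtrack, since deleting the backtrack would shorten
  it.\<close>

lemma ex_nonbacktracking_walk:
  assumes "walk E p xs q" shows "\<exists>ys. walk E p ys q \<and> nonbacktracking ys"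
proof -
  obtain ys where ys: "walk E p ys q" "\<And>zs. walk E p zs q \<Longrightarrow> length ys \<le> length zs"
    using ex_has_least_nat[of "\<lambda>xs. walk E p xs q" xs length] assms by blast
  have "nonbacktracking ys"
  proof (rule ccontr)
    assume "\<not> nonbacktracking ys"
    then obtain as x y cs where eq: "ys = as @ x # y # x # cs"
      using not_nonbacktracking_decomp by metis
    then have "walk E p (as @ x # cs) q" using ys(1) walk_remove_backtrack by simp
    from ys(2)[OF this] show False by (simp add: eq)
  qed
  with ys(1) show ?thesis by blast
qed

lemma walk_rev: "walk E p xs q \<Longrightarrow> walk E q (rev xs) p"
  by (auto simp: walk_def hd_rev last_rev insert_commute)

lemma walk_if_rtrancl: "(p, q) \<in> {(x, y). {x, y} \<in> E}\<^sup>* \<Longrightarrow> \<exists>xs. walk E p xs q"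
proof (induction rule: converse_rtrancl_induct)
  case base
  then show ?case using walk_single by metis
next
  case (step y z)
  then obtain xs where "walk E z xs q" by auto
  moreover then obtain xs' where "xs = z # xs'" by (cases xs) (auto simp: walk_def)
  ultimately have "walk E y (y # xs) q" using step by (auto simp: walk_Cons)
  then show ?case by blast
qed

lemma rtrancl_if_walk: "walk E p xs q \<Longrightarrow> x \<in> set xs \<Longrightarrow> (p, x) \<in> {(x, y). {x, y} \<in> E}\<^sup>*"
proof (induction xs arbitrary: p rule: induct_list012)
  case (3 y z zs)
  then show ?case
    by (auto simp: walk_Cons intro: converse_rtrancl_into_rtrancl)
qed (auto simp: walk_single)

section \<open>Uniqueness of geodesics and parity of crossings in a forest\<close>

locale forest =
  fixes E :: "'v set set"
  assumes no_loop: "{v, v} \<notin> E" and no_cycle: "\<not> simple_cycle E xs"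
begin

text \<open>Between two visits to \<open>y\<close> lies a closed piece. Without its last vertex it
  is shorter, hence distinct by induction, and closes up to a cycle. It has at least three vertices:
  one would give a loop, two a backtrack.\<close>

lemma distinct_if_nonbacktracking:
  "walk E p xs q \<Longrightarrow> nonbacktracking xs \<Longrightarrow> distinct xs"
proof (induction xs arbitrary: p q rule: length_induct)
  case (1 xs)
  show ?case
  proof (rule ccontr)
    assume "\<not> distinct xs"
    then obtain as y ys zs where xs: "xs = as @ y # ys @ y # zs"
      using not_distinct_decomp by fastforce
    have w: "walk E y (y # ys @ [y]) y"
      using 1(2) walk_join[of E p as y "ys @ y # zs" q] walk_join[of E y "y # ys" y zs q]
      by (simp add: xs)
    then have w': "walk E y (y # ys) (last (y # ys))" and l: "{last (y # ys), y} \<in> E"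
      using successively_append_iff[of "\<lambda>x y. {x, y} \<in> E" "y # ys" "[y]"] by (auto simp: walk_def)
    have nb: "nonbacktracking (y # ys)"
      using 1(3) not_nonbacktracking_decomp
      by (metis (no_types, opaque_lifting) append.assoc append_Cons xs)
    have d: "distinct (y # ys)"
      using 1(1)[rule_format, OF _ w' nb] by (simp add: xs)
    have "ys \<noteq> []" using l no_loop by auto
    moreover have "ys \<noteq> [z]" for z using 1(3) not_nonbacktracking_decomp
      by (metis append_Cons append_Nil xs)
    ultimately have "length (y # ys) \<ge> 3"
      by (cases ys rule: remdups_adj.cases) auto
    then have "simple_cycle E (y # ys)"
      using d w' l by (simp add: simple_cycle_def walk_def)
    then show False using no_cycle by blast
  qed
qed

lemma closed_nonbacktracking:
  assumes "walk E p xs p" "nonbacktracking xs" shows "xs = [p]"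
  using distinct_if_nonbacktracking[OF assms] assms(1)
  by (cases xs) (auto simp: walk_def split: if_splits)

text \<open>If the first steps differ, the reverse of one walk followed by the other is a
  nonbacktracking closed walk of positive length, which is impossible. So the first steps agree, and
  induction applies.\<close>

lemma nonbacktracking_unique:
  "walk E p xs q \<Longrightarrow> walk E p ys q \<Longrightarrow> nonbacktracking xs \<Longrightarrow> nonbacktracking ys \<Longrightarrow> xs = ys"
proof (induction xs arbitrary: p ys rule: induct_list012)
  case 1
  then show ?case by (simp add: walk_def)
next
  case (2 x)
  then show ?case using closed_nonbacktracking by (metis walk_single)
next
  case (3 x x' xs)
  show ?case
  proof (cases ys rule: remdups_adj.cases)
    case 1
    then show ?thesis using 3(4) by (simp add: walk_def)
  next
    case (2 y)
    then show ?thesis using 3 closed_nonbacktracking by (metis walk_single)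
  next
    case ys: (3 y y' ys')
    have p: "x = p" "y = p" using 3 ys by (auto simp: walk_Cons)
    have nb: "nonbacktracking (x' # xs)" "nonbacktracking (y' # ys')"
      using 3(5,6) not_nonbacktracking_decomp unfolding ys by (metis append_Cons)+
    have "x' = y'"
    proof (rule ccontr)
      assume "x' \<noteq> y'"
      have "walk E q (rev xs @ x' # p # y' # ys') q"
        using walk_rev[OF 3(3)] 3(4) walk_join[of E q "rev xs @ [x']" p "y' # ys'" q] by (simp add: ys p)
      moreover have "nonbacktracking (rev xs @ x' # p # y' # ys')"
        using 3(5,6) \<open>x' \<noteq> y'\<close> nonbacktracking_rev[of "x # x' # xs"]
        by (subst nonbacktracking_join) (auto simp: ys p)
      ultimately show False using closed_nonbacktracking by fastforce
    qed
    then show ?thesis using 3 nb by (auto simp: ys walk_Cons)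
  qed
qed

text \<open>Deleting backtracks shrinks a closed walk to a point. Each deletion removes two
  crossings of one edge and so preserves the parity.\<close>

lemma crossing_parity_closed: "walk E p xs p \<Longrightarrow> \<not> crossing_parity A xs"
proof (induction xs rule: length_induct)
  case (1 xs)
  show ?case
  proof (cases "nonbacktracking xs")
    case True
    then show ?thesis using 1 closed_nonbacktracking by fastforce
  next
    case False
    then obtain as x y cs where xs: "xs = as @ x # y # x # cs"
      using not_nonbacktracking_decomp by metis
    have "walk E p (as @ x # cs) p"
      using 1(2) walk_remove_backtrack by (simp add: xs)
    then have "\<not> crossing_parity A (as @ x # cs)" using 1(1) by (simp add: xs)
    then show ?thesis
      using crossing_parity_join[of A as x cs] crossing_parity_join[of A as x "y # x # cs"]
      by (auto simp: xs insert_commute)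
  qed
qed

text \<open>In a forest every walk from \<open>p\<close> to \<open>q\<close> has the same parity, as
  \<open>separated_iff\<close> shows, so the existential quantifier amounts to evaluating on any
  walk.\<close>

definition separated :: "'v set set \<Rightarrow> 'v \<Rightarrow> 'v \<Rightarrow> bool" where
  "separated A p q \<longleftrightarrow> (\<exists>xs. walk E p xs q \<and> crossing_parity A xs)"

lemma crossing_parity_concat:
  assumes "walk E p xs q" "walk E q ys r"
  shows "walk E p (xs @ tl ys) r"
    "crossing_parity A (xs @ tl ys) \<longleftrightarrow> crossing_parity A xs \<noteq> crossing_parity A ys"
proof -
  obtain ys' where ys: "ys = q # ys'" using assms by (cases ys) (auto simp: walk_def)
  obtain xs' where xs: "xs = xs' @ [q]" using assms by (cases xs rule: rev_cases) (auto simp: walk_def)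
  show "walk E p (xs @ tl ys) r" using assms walk_join[of E p xs' q ys' r] by (simp add: xs ys)
  show "crossing_parity A (xs @ tl ys) \<longleftrightarrow> crossing_parity A xs \<noteq> crossing_parity A ys"
    using crossing_parity_join[of A xs' q ys'] by (simp add: xs ys)
qed

text \<open>Followed by the reverse of \<open>xs\<close>, both walks become closed and thus even.
  Hence both have the parity of that reverse.\<close>

lemma separated_iff:
  assumes "walk E p xs q" shows "separated A p q \<longleftrightarrow> crossing_parity A xs"
proof -
  have "crossing_parity A xs \<longleftrightarrow> crossing_parity A ys" if "walk E p ys q" for ys
  proof -
    note c = crossing_parity_concat[OF _ walk_rev[OF assms]]
    show ?thesis
      using crossing_parity_closed[OF c(1)[OF assms], of A] c(2)[OF assms, of A]
        crossing_parity_closed[OF c(1)[OF that], of A] c(2)[OF that, of A] by blast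
  qed
  then show ?thesis unfolding separated_def using assms by blast
qed

lemma separated_edge: "{p, q} \<in> E \<Longrightarrow> separated A p q \<longleftrightarrow> {p, q} \<in> A"
  using separated_iff[of p "[p, q]" q A] by (simp add: walk_def)

end

section \<open>Trees with a group action\<close>

locale g_tree = group G for G :: "('g, 'm) monoid_scheme" (structure) +
  fixes T :: "('g, 'v) gtree"
  assumes G_tree: "G_tree G T"
begin

lemma edge_cases:
  assumes "e \<in> edges T"
  obtains v w where "v \<in> verts T" "w \<in> verts T" "v \<noteq> w" "e = {v, w}"
  using G_tree assms unfolding G_tree_def is_tree_def by blast

lemma edgeD: "{v, w} \<in> edges T \<Longrightarrow> v \<in> verts T \<and> w \<in> verts T \<and> v \<noteq> w"
  by (metis doubleton_eq_iff edge_cases)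

sublocale forest "edges T"
proof
  show "{v, v} \<notin> edges T" for v using edgeD by blast
  show "\<not> simple_cycle (edges T) xs" for xs using G_tree by (auto simp: G_tree_def is_tree_def)
qed

sublocale V: gset G "verts T" "act T"
proof
  interpret A: group_action G "verts T" "act T" using G_tree by (simp add: G_tree_def)
  show "act T g x \<in> verts T" if "g \<in> carrier G" "x \<in> verts T" for g x
    using that A.element_image by blast
  show "act T \<one> x = x" if "x \<in> verts T" for x
    using that A.id_eq_one by (metis restrict_apply')
  show "act T (g \<otimes> h) x = act T g (act T h x)"
    if "g \<in> carrier G" "h \<in> carrier G" "x \<in> verts T" for g h x
    using that A.composition_rule by blast
qed

lemma edge_act_pair [simp]: "edge_act T g {v, w} = {act T g v, act T g w}"
  by (simp add: edge_act_def)

sublocale E: gset G "edges T" "edge_act T"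
proof
  show "edge_act T g e \<in> edges T" if "g \<in> carrier G" "e \<in> edges T" for g e
    using G_tree that by (simp add: G_tree_def)
  show "edge_act T \<one> e = e" if "e \<in> edges T" for e
    using that by (auto elim!: edge_cases simp: V.act_one)
  show "edge_act T (g \<otimes> h) e = edge_act T g (edge_act T h e)"
    if "g \<in> carrier G" "h \<in> carrier G" "e \<in> edges T" for g h e
    using that by (auto elim!: edge_cases simp: V.act_mult)
qed

lemma vstab_subgroup: "v \<in> verts T \<Longrightarrow> subgroup (vstab G T v) G"
  unfolding vstab_def using G_tree group_action.stabilizer_subgroup by (auto simp: G_tree_def)

text \<open>An element preserving an edge fixes its endpoints or swaps them, and inversions are
  excluded.\<close>

lemma estab_pair:
  assumes "{v, w} \<in> edges T" shows "estab G T {v, w} = vstab G T v \<inter> vstab G T w"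
proof -
  have "\<not> (act T g v = w \<and> act T g w = v)" if "g \<in> carrier G" for g
    using G_tree that assms unfolding G_tree_def by blast
  then show ?thesis by (auto simp: estab_def vstab_def stabilizer_def doubleton_eq_iff)
qed

lemma ex_walk: "p \<in> verts T \<Longrightarrow> q \<in> verts T \<Longrightarrow> \<exists>xs. walk (edges T) p xs q"
  using G_tree by (intro walk_if_rtrancl) (simp add: G_tree_def is_tree_def)

lemma walk_verts: "walk (edges T) p xs q \<Longrightarrow> p \<in> verts T \<Longrightarrow> set xs \<subseteq> verts T"
  by (induction xs arbitrary: p rule: induct_list012) (auto simp: walk_Cons walk_single dest: edgeD)

lemma walk_act:
  "g \<in> carrier G \<Longrightarrow> walk (edges T) p xs q \<Longrightarrow> walk (edges T) (act T g p) (map (act T g) xs) (act T g q)"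
proof (induction xs arbitrary: p rule: induct_list012)
  case (3 x y zs)
  then show ?case using E.closed[of g "{x, y}"] by (auto simp: walk_Cons)
qed (auto simp: walk_def)

text \<open>The geodesic from \<open>p\<close> to \<open>q\<close>, being unique, is fixed by whatever fixes \<open>p\<close> and \<open>q\<close>.\<close>

lemma ex_fixed_walk:
  assumes "p \<in> verts T" "q \<in> verts T"
  obtains xs where "walk (edges T) p xs q" "\<And>x. x \<in> set xs \<Longrightarrow> vstab G T p \<inter> vstab G T q \<subseteq> vstab G T x"
proof -
  obtain ys where "walk (edges T) p ys q" using ex_walk[OF assms] by blast
  from ex_nonbacktracking_walk[OF this]
  obtain xs where xs: "walk (edges T) p xs q" "nonbacktracking xs" by blast
  have *: "map (act T h) xs = xs" if "h \<in> vstab G T p \<inter> vstab G T q" for h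
  proof (rule nonbacktracking_unique[OF _ xs(1) _ xs(2)])
    have h: "h \<in> carrier G" "act T h p = p" "act T h q = q"
      using that by (auto simp: vstab_def stabilizer_def)
    show "walk (edges T) p (map (act T h) xs) q" using walk_act[OF h(1) xs(1)] h by simp
    have "inj_on (act T h) (set xs)"
      using walk_verts[OF xs(1) assms(1)] h(1) by (meson V.act_inj inj_onI subsetD)
    then show "nonbacktracking (map (act T h) xs)" using xs(2) nonbacktracking_map by blast
  qed
  have "vstab G T p \<inter> vstab G T q \<subseteq> vstab G T x" if "x \<in> set xs" for x
  proof
    fix h assume h: "h \<in> vstab G T p \<inter> vstab G T q"
    then have "map (act T h) xs = map (\<lambda>x. x) xs" using * by simp
    then have "act T h x = x" using \<open>x \<in> set xs\<close> by (simp only: map_eq_conv)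
    then show "h \<in> vstab G T x" using h by (simp add: vstab_def stabilizer_def)
  qed
  with xs(1) show thesis using that by blast
qed


text \<open>Join a base vertex to its images under a finite generating set. The translates of this
  finite piece form a connected invariant subgraph, hence a subtree, which is everything by
  minimality. So every edge orbit meets the finite piece.\<close>

lemma finite_edge_orbits:
  assumes "finitely_generated G"
  shows "finite (orbits G (edges T) (edge_act T))"
proof -
  obtain S where S: "finite S" "S \<subseteq> carrier G" "generate G S = carrier G"
    using assms by (auto simp: finitely_generated_def)
  obtain v0 where v0: "v0 \<in> verts T" using G_tree by (auto simp: G_tree_def is_tree_def)
  have "\<forall>s\<in>S. \<exists>xs. walk (edges T) v0 xs (act T s v0)"
    using S(2) v0 V.closed by (intro ballI ex_walk) auto
  from bchoice[OF this] obtain p where p: "\<And>s. s \<in> S \<Longrightarrow> walk (edges T) v0 (p s) (act T s v0)"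
    by blast
  \<comment> \<open>Inserting \<open>v0\<close> keeps \<open>P\<close> nonempty even when
    \<open>S\<close> is empty.\<close>
  define P where "P = insert v0 (\<Union>s\<in>S. set (p s))"
  define F\<^sub>0 where "F\<^sub>0 = {e \<in> edges T. e \<subseteq> P}"
  define W where "W = (\<Union>g\<in>carrier G. act T g ` P)"
  define F where "F = (\<Union>g\<in>carrier G. edge_act T g ` F\<^sub>0)"
  define R where "R = {(x, y). {x, y} \<in> F}\<^sup>*"
  have P: "P \<subseteq> verts T" using walk_verts[OF p v0] v0 by (auto simp: P_def)
  have "finite P" using S(1) by (auto simp: P_def)
  then have "finite F\<^sub>0" by (auto simp: F\<^sub>0_def intro: finite_subset[of _ "Pow P"])
  have F0: "F\<^sub>0 \<subseteq> edges T" by (auto simp: F\<^sub>0_def)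
  have F_edges: "F \<subseteq> edges T" using F0 E.closed by (auto simp: F_def)
  have F_act: "edge_act T g e \<in> F" if g: "g \<in> carrier G" and e: "e \<in> F" for g e
  proof -
    obtain h e' where h: "h \<in> carrier G" "e' \<in> F\<^sub>0" "e = edge_act T h e'" using e by (auto simp: F_def)
    then have "edge_act T g e = edge_act T (g \<otimes> h) e'" using g F0 E.act_mult by auto
    then show ?thesis using h g by (auto simp: F_def)
  qed
  have W_act: "act T g x \<in> W" if g: "g \<in> carrier G" and x: "x \<in> W" for g x
  proof -
    obtain h y where h: "h \<in> carrier G" "y \<in> P" "x = act T h y" using x by (auto simp: W_def)
    then have "act T g x = act T (g \<otimes> h) y" using g P V.act_mult by auto
    then show ?thesis using h g by (auto simp: W_def)
  qed
  have R_act: "(act T g x, act T g y) \<in> R" if g: "g \<in> carrier G" and "(x, y) \<in> R" for g x y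
    using that(2) unfolding R_def
  proof (induction rule: rtrancl_induct)
    case (step y z)
    have "(act T g y, act T g z) \<in> {(x, y). {x, y} \<in> F}" using F_act[OF g, of "{y, z}"] step(2) by simp
    with step(3) show ?case by (rule rtrancl_into_rtrancl)
  qed simp
  have R_sym: "(y, x) \<in> R" if "(x, y) \<in> R" for x y
  proof -
    have "sym R" unfolding R_def by (rule sym_rtrancl) (auto simp: sym_def insert_commute)
    then show ?thesis using that by (rule symD)
  qed
  have R_trans: "(x, z) \<in> R" if "(x, y) \<in> R" "(y, z) \<in> R" for x y z
    using that unfolding R_def by (rule rtrancl_trans)
  have "F\<^sub>0 \<subseteq> F"
  proof
    fix e assume e: "e \<in> F\<^sub>0"
    then have "e = edge_act T \<one> e" using F0 E.act_one by auto
    with e show "e \<in> F" by (auto simp: F_def)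
  qed
  have R_path: "(v0, x) \<in> R" if s: "s \<in> S" "x \<in> set (p s)" for s x
  proof -
    have "walk F\<^sub>0 v0 (p s) (act T s v0)"
      unfolding F\<^sub>0_def using p s by (intro walk_restrict) (auto simp: P_def)
    then have "(v0, x) \<in> {(x, y). {x, y} \<in> F\<^sub>0}\<^sup>*" using s(2) by (rule rtrancl_if_walk)
    moreover have "{(x, y). {x, y} \<in> F\<^sub>0} \<subseteq> {(x, y). {x, y} \<in> F}" using \<open>F\<^sub>0 \<subseteq> F\<close> by auto
    ultimately show ?thesis unfolding R_def using rtrancl_mono by blast
  qed
  have R_P: "(v0, x) \<in> R" if "x \<in> P" for x
    using that R_path by (auto simp: P_def R_def)
  have R_S: "(v0, act T s v0) \<in> R" if "s \<in> S" for s
    using R_path[OF that] p[OF that] by (metis last_in_set walk_def)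
  \<comment> \<open>Induction on words: a path to \<open>act T g v0\<close> is continued by the
    \<open>g\<close>-translate of a path to \<open>act T h v0\<close>. For an inverse generator, the
    path of the generator is translated back and reversed.\<close>
  have R_orbit: "(v0, act T g v0) \<in> R" if "g \<in> generate G S" for g
    using that
  proof (induction rule: generate.induct)
    case one
    then show ?case using V.act_one v0 by (simp add: R_def)
  next
    case (incl s)
    then show ?case using R_S by blast
  next
    case (inv s)
    have "s \<in> carrier G" using inv S(2) by blast
    then have "(act T (inv s) v0, v0) \<in> R" using R_act[of "inv s", OF _ R_S[OF inv]] v0 by simp
    then show ?case by (rule R_sym)
  next
    case (eng g h)
    then have c: "g \<in> carrier G" "h \<in> carrier G" using S(3) by auto
    show ?case
      using R_trans[OF eng(3) R_act[OF c(1) eng(4)]] c v0 V.act_mult by simp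
  qed
  have R_W: "(v0, x) \<in> R" if "x \<in> W" for x
  proof -
    obtain g y where g: "g \<in> carrier G" "y \<in> P" "x = act T g y" using \<open>x \<in> W\<close> by (auto simp: W_def)
    then have "(act T g v0, x) \<in> R" using R_act R_P by simp
    then show ?thesis using R_orbit[of g] R_trans g S(3) by blast
  qed
  have "is_tree W F"
    unfolding is_tree_def
  proof (intro conjI ballI notI)
    have "act T \<one> v0 \<in> W" by (auto simp: W_def P_def)
    then show "W = {} \<Longrightarrow> False" by auto
    show "\<exists>v\<in>W. \<exists>w\<in>W. v \<noteq> w \<and> e = {v, w}" if "e \<in> F" for e
    proof -
      obtain g e' where g: "g \<in> carrier G" "e' \<in> F\<^sub>0" "e = edge_act T g e'" using \<open>e \<in> F\<close> by (auto simp: F_def)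
      then obtain v w where v: "v \<in> P" "w \<in> P" "e' = {v, w}"
        using F0 by (auto simp: F\<^sub>0_def elim!: edge_cases)
      have "act T g v \<noteq> act T g w" using edgeD[of "act T g v" "act T g w"] F_edges that g v by auto
      then show ?thesis using g v by (auto simp: W_def)
    qed
    show "(v, w) \<in> {(x, y). {x, y} \<in> F}\<^sup>*" if "v \<in> W" "w \<in> W" for v w
      using R_trans[OF R_sym[OF R_W[OF that(1)]] R_W[OF that(2)]] by (simp add: R_def)
    show False if "\<exists>xs. simple_cycle F xs"
    proof -
      obtain xs where "simple_cycle F xs" using \<open>\<exists>xs. simple_cycle F xs\<close> by blast
      then have "simple_cycle (edges T) xs"
        unfolding simple_cycle_def using F_edges by (auto elim: successively_mono)
      then show False using no_cycle by blast
    qed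
  qed
  moreover have "W \<subseteq> verts T" using P V.closed by (auto simp: W_def)
  ultimately have "invariant_subtree G T W F"
    using F_edges W_act F_act by (simp add: invariant_subtree_def)
  then have "F = edges T" using G_tree unfolding G_tree_def by blast
  have "orbits G (edges T) (edge_act T) \<subseteq> orbit G (edge_act T) ` F\<^sub>0"
  proof
    fix oo assume "oo \<in> orbits G (edges T) (edge_act T)"
    then obtain e where e: "e \<in> F" "oo = orbit G (edge_act T) e"
      using \<open>F = edges T\<close> by (auto simp: orbits_def)
    then obtain g e' where g: "g \<in> carrier G" "e' \<in> F\<^sub>0" "e = edge_act T g e'" by (auto simp: F_def)
    then have "oo = orbit G (edge_act T) e'" using e F0 E.orbit_act by auto
    then show "oo \<in> orbit G (edge_act T) ` F\<^sub>0" using g by blast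
  qed
  then show ?thesis using \<open>finite F\<^sub>0\<close> finite_surj by blast
qed

text \<open>The vertex group is the stabilizer of \<open>u\<close> conjugated by the transporter,
  which is also the conjugation defining the inclusion. Being injective, the conjugation can be
  cancelled.\<close>

lemma inclusion_onto_iff:
  assumes e: "{u, w} \<in> edges T" and y: "lift y = {u, w}"
  shows "inclusion_onto G T y u \<longleftrightarrow> estab G T {u, w} = vstab G T u"
proof -
  have u: "u \<in> verts T" using edgeD[OF e] by blast
  let ?t = "transporter G T u"
  have "lift (orbit G (act T) u) \<in> orbit G (act T) u"
    unfolding lift_def using V.orbit_self[OF u] by (rule someI)
  then have "\<exists>g. g \<in> carrier G \<and> act T g u = lift (orbit G (act T) u)"
    by (auto simp: orbit_def)
  then have t: "?t \<in> carrier G \<and> act T ?t u = lift (orbit G (act T) u)"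
    unfolding transporter_def by (rule someI_ex)
  let ?c = "\<lambda>h. ?t \<otimes> h \<otimes> inv ?t"
  have inj: "inj_on ?c (carrier G)" using t by (auto intro!: inj_onI)
  have sub: "estab G T {u, w} \<subseteq> carrier G" "vstab G T u \<subseteq> carrier G"
    by (auto simp: estab_def vstab_def stabilizer_def)
  have "vertex_group G T (orbit G (act T) u) = vstab G T (act T ?t u)"
    using t by (simp add: vertex_group_def)
  also have "\<dots> = ?c ` vstab G T u"
    unfolding vstab_def
  proof (intro subset_antisym subsetI)
    fix h assume "h \<in> stabilizer G (act T) (act T ?t u)"
    then have h: "h \<in> carrier G" "inv ?t \<otimes> h \<otimes> ?t \<in> stabilizer G (act T) u"
      using t u V.stabilizer_act_iff by blast+
    have "?t \<otimes> (inv ?t \<otimes> h) = h" using h(1) t by (simp flip: m_assoc)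
    then have "h = ?c (inv ?t \<otimes> h \<otimes> ?t)" using h(1) t by (simp add: m_assoc)
    with h(2) show "h \<in> ?c ` stabilizer G (act T) u" by blast
  next
    fix h assume "h \<in> ?c ` stabilizer G (act T) u"
    then obtain k where k: "k \<in> stabilizer G (act T) u" "h = ?c k" by blast
    then have "k \<in> carrier G" by (simp add: stabilizer_def)
    then have "h \<in> carrier G" "inv ?t \<otimes> h \<otimes> ?t = k"
      using k t by (simp_all add: m_assoc inv_solve_left')
    then show "h \<in> stabilizer G (act T) (act T ?t u)"
      using V.stabilizer_act_iff[OF conjunct1[OF t] u, of h] k(1) by simp
  qed
  finally show ?thesis
    unfolding inclusion_onto_def edge_inclusion_def edge_group_def y
    using inj_on_image_eq_iff[OF inj sub] by simp
qed

text \<open>Reducedness puts both endpoints in one orbit, so the edge becomes a loop in the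
  quotient. One inclusion is onto; as the loop is not strictly ascending, so is the other.\<close>

lemma vstab_eq_if_estab_eq:
  assumes e: "{v, w} \<in> edges T" and "reduced G T" "\<nexists>y. strict_ascending_loop G T y"
    and eq: "estab G T {v, w} = vstab G T v"
  shows "vstab G T w = vstab G T v" "orbit G (act T) w = orbit G (act T) v"
proof -
  show orb: "orbit G (act T) w = orbit G (act T) v"
    using assms(2) e eq unfolding reduced_def by blast
  let ?y = "orbit G (edge_act T) {v, w}"
  have y: "?y \<in> quotient_edges G T" using e by (auto simp: quotient_edges_def orbits_def)
  \<comment> \<open>The graph of groups only sees the chosen lift, a translate of the given edge.
    The comparison is made there and carried back by \<open>stabilizer_eq_act_iff\<close>.\<close>
  have "lift ?y \<in> ?y" unfolding lift_def using E.orbit_self[OF e] by (rule someI)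
  then obtain g where g: "g \<in> carrier G" "lift ?y = {act T g v, act T g w}"
    by (auto simp: orbit_def)
  have v: "v \<in> verts T" "w \<in> verts T" using edgeD e by blast+
  have e': "{act T g v, act T g w} \<in> edges T" using E.closed[OF g(1) e] by simp
  have "inclusion_onto G T ?y (act T g v) \<longleftrightarrow> inclusion_onto G T ?y (act T g w)"
    using assms(3) y g(2) V.orbit_act[OF g(1)] v orb unfolding strict_ascending_loop_def by metis
  then have "estab G T (edge_act T g {v, w}) = vstab G T (act T g v) \<longleftrightarrow>
      estab G T (edge_act T g {v, w}) = vstab G T (act T g w)"
    using inclusion_onto_iff[OF e' g(2)] inclusion_onto_iff[of "act T g w" "act T g v" ?y] e' g(2)
    by (simp add: insert_commute)
  then show "vstab G T w = vstab G T v"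
    using stabilizer_eq_act_iff[OF E.gset_axioms V.gset_axioms g(1) e] v eq
    unfolding vstab_def estab_def by metis
qed

text \<open>The stabilizer of \<open>v\<close> fixes the geodesic to \<open>w\<close>, so it equals
  the stabilizer of the first edge. By \<open>vstab_eq_if_estab_eq\<close> the next vertex has the
  same stabilizer and orbit, and the argument moves along the geodesic.\<close>

lemma vstab_maximal:
  assumes "reduced G T" "\<nexists>y. strict_ascending_loop G T y"
    and "v \<in> verts T" "w \<in> verts T" "vstab G T v \<subseteq> vstab G T w"
  shows "vstab G T w = vstab G T v \<and> orbit G (act T) w = orbit G (act T) v"
proof -
  have *: "vstab G T w = vstab G T v \<and> orbit G (act T) w = orbit G (act T) v"
    if "walk (edges T) v xs w" "\<And>x. x \<in> set xs \<Longrightarrow> vstab G T v \<subseteq> vstab G T x" for xs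
    using that
  proof (induction xs arbitrary: v rule: induct_list012)
    case (3 x y zs)
    have e: "{v, y} \<in> edges T" and w: "walk (edges T) y (y # zs) w" using 3(3) by (auto simp: walk_Cons)
    have "estab G T {v, y} = vstab G T v" using estab_pair[OF e] 3(4)[of y] by auto
    note eq = vstab_eq_if_estab_eq[OF e assms(1,2) this]
    have "vstab G T w = vstab G T y \<and> orbit G (act T) w = orbit G (act T) y"
      using 3(2)[OF w] 3(4) eq(1) by simp
    with eq show ?case by simp
  qed (auto simp: walk_single)
  obtain xs where "walk (edges T) v xs w" "\<And>x. x \<in> set xs \<Longrightarrow> vstab G T v \<inter> vstab G T w \<subseteq> vstab G T x"
    using ex_fixed_walk[OF assms(3,4)] by metis
  then show ?thesis using * assms(5) by (metis inf.absorb1)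
qed

end

section \<open>Elliptic subgroups determine the vertices\<close>

context g_tree
begin

lemma elliptic_subgroups_iff:
  "H \<in> elliptic_subgroups G T \<longleftrightarrow> subgroup H G \<and> (\<exists>v\<in>verts T. H \<subseteq> vstab G T v)"
  by (fastforce simp: elliptic_subgroups_def vstab_def stabilizer_def dest: subgroup.mem_carrier)

text \<open>A vertex stabilizer of \<open>T\<close> is elliptic, so it lies in one of
  \<open>T'\<close>, which in turn lies in one of \<open>T\<close>. Maximality in \<open>T\<close>
  collapses this chain to equalities.\<close>

lemma vstabs_subset:
  assumes T': "g_tree G T'" and ell: "elliptic_subgroups G T = elliptic_subgroups G T'"
    and red: "reduced G T" and asc: "\<nexists>y. strict_ascending_loop G T y"
  shows "vstab G T ` verts T \<subseteq> vstab G T' ` verts T'"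
proof
  interpret T': g_tree G T' by fact
  fix K assume "K \<in> vstab G T ` verts T"
  then obtain v where v: "v \<in> verts T" "K = vstab G T v" by blast
  have "K \<in> elliptic_subgroups G T'"
    using v vstab_subgroup elliptic_subgroups_iff ell by blast
  then obtain w where w: "w \<in> verts T'" "K \<subseteq> vstab G T' w"
    using T'.elliptic_subgroups_iff by blast
  have "vstab G T' w \<in> elliptic_subgroups G T"
    using w T'.vstab_subgroup T'.elliptic_subgroups_iff ell by blast
  then obtain u where u: "u \<in> verts T" "vstab G T' w \<subseteq> vstab G T u"
    using elliptic_subgroups_iff by blast
  have "vstab G T u = K" using vstab_maximal[OF red asc v(1) u(1)] w u v by blast
  then have "K = vstab G T' w" using w u by blast
  then show "K \<in> vstab G T' ` verts T'" using w by blast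
qed

lemma vertex_orbits_of_vstab:
  assumes "reduced G T" "\<nexists>y. strict_ascending_loop G T y" and v: "v \<in> verts T"
  shows "{oo \<in> orbits G (verts T) (act T). vstab G T v \<in> vstab G T ` oo} = {orbit G (act T) v}"
proof -
  have "oo = orbit G (act T) v"
    if "oo \<in> orbits G (verts T) (act T)" "w \<in> oo" "vstab G T v = vstab G T w" for oo w
    using V.in_orbits_eq[OF that(1,2)] vstab_maximal[OF assms, of w] that(3) by blast
  then show ?thesis using V.orbit_self[OF v] v by (auto simp: orbits_def)
qed

lemma vertex_equivariant_bijection:
  assumes T': "g_tree G T'" and ell: "elliptic_subgroups G T = elliptic_subgroups G T'"
    and red: "reduced G T" "reduced G T'"
    and asc: "\<nexists>y. strict_ascending_loop G T y" "\<nexists>y. strict_ascending_loop G T' y"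
  shows "\<exists>f. equivariant_bijection G (verts T) (act T) (verts T') (act T') f"
proof (rule equivariant_bijection_of_orbits)
  interpret T': g_tree G T' by fact
  show "gset G (verts T) (act T)" "gset G (verts T') (act T')"
    by (rule V.gset_axioms T'.V.gset_axioms)+
  fix K
  have vstabs: "vstab G T ` verts T = vstab G T' ` verts T'"
    using vstabs_subset[OF T' ell red(1) asc(1)]
      T'.vstabs_subset[OF g_tree_axioms ell[symmetric] red(2) asc(2)] by (rule subset_antisym)
  have "\<exists>\<beta>. bij_betw \<beta> {oo \<in> orbits G (verts T) (act T). K \<in> vstab G T ` oo}
      {oo \<in> orbits G (verts T') (act T'). K \<in> vstab G T' ` oo}"
  \<comment> \<open>\<open>K\<close> is a vertex stabilizer in both trees or in neither. Accordingly
    both families of orbits are singletons or both are empty.\<close>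
  proof (cases "K \<in> vstab G T ` verts T")
    case True
    obtain v where v: "v \<in> verts T" "vstab G T v = K" using True by blast
    obtain w where w: "w \<in> verts T'" "vstab G T' w = K" using True unfolding vstabs by blast
    show ?thesis
      unfolding vertex_orbits_of_vstab[OF red(1) asc(1) v(1), unfolded v(2)]
        T'.vertex_orbits_of_vstab[OF red(2) asc(2) w(1), unfolded w(2)]
      by (rule exI[of _ "\<lambda>_. orbit G (act T') w"]) (simp add: bij_betw_def)
  next
    case False
    then have "K \<notin> vstab G T' ` verts T'" by (simp add: vstabs)
    with False have empty: "{oo \<in> orbits G (verts T) (act T). K \<in> vstab G T ` oo} = {}"
      "{oo \<in> orbits G (verts T') (act T'). K \<in> vstab G T' ` oo} = {}"
      using V.in_orbits_eq T'.V.in_orbits_eq by blast+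
    show ?thesis unfolding empty by (simp add: bij_betw_def)
  qed
  then show "\<exists>\<beta>. bij_betw \<beta> {oo \<in> orbits G (verts T) (act T). K \<in> stabilizer G (act T) ` oo}
      {oo \<in> orbits G (verts T') (act T'). K \<in> stabilizer G (act T') ` oo}"
    by (simp add: vstab_def[abs_def])
qed

end

section \<open>Counting edge orbits\<close>

context g_tree
begin

text \<open>An orbit in \<open>Q\<close> may also contain edges whose stabilizers are other
  conjugates of \<open>K\<close>. Only those with stabilizer exactly \<open>K\<close> are kept, so
  that the set is preserved by elements normalizing \<open>K\<close>.\<close>

definition edges_over :: "'g set \<Rightarrow> 'v set set set \<Rightarrow> 'v set set" where
  "edges_over K Q = {e \<in> edges T. estab G T e = K \<and> orbit G (edge_act T) e \<in> Q}"

text \<open>Parities add under concatenation of walks. This is the cocycle identity mod 2.\<close>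

lemma separated_trans:
  assumes "p \<in> verts T" "q \<in> verts T" "r \<in> verts T"
  shows "separated A p r \<longleftrightarrow> separated A p q \<noteq> separated A q r"
proof -
  obtain xs ys where w: "walk (edges T) p xs q" "walk (edges T) q ys r"
    using ex_walk assms by metis
  show ?thesis
    using separated_iff[OF w(1)] separated_iff[OF w(2)]
      separated_iff[OF crossing_parity_concat(1)[OF w]] crossing_parity_concat(2)[OF w] by blast
qed

lemma separated_refl: "p \<in> verts T \<Longrightarrow> \<not> separated A p p"
  using separated_trans by blast

lemma separated_sym: "p \<in> verts T \<Longrightarrow> q \<in> verts T \<Longrightarrow> separated A p q \<longleftrightarrow> separated A q p"
  using separated_trans[of p q p] separated_refl by blast

text \<open>Every edge of the geodesic is fixed by the common stabilizer of \<open>p\<close> and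
  \<open>q\<close>. Its stabilizer is therefore larger than \<open>K\<close>, and the geodesic
  crosses no edge of the set.\<close>

lemma not_separated_edges_over:
  assumes "p \<in> verts T" "q \<in> verts T" and K: "K \<subset> vstab G T p \<inter> vstab G T q"
  shows "\<not> separated (edges_over K Q) p q"
proof -
  obtain xs where xs: "walk (edges T) p xs q"
    "\<And>x. x \<in> set xs \<Longrightarrow> vstab G T p \<inter> vstab G T q \<subseteq> vstab G T x"
    using ex_fixed_walk[OF assms(1,2)] by blast
  have "\<not> crossing_parity (edges_over K Q) ys" if "walk (edges T) r ys q" "set ys \<subseteq> set xs" for r ys
    using that
  proof (induction ys arbitrary: r rule: induct_list012)
    case (3 x y zs)
    then have e: "{x, y} \<in> edges T" by (auto simp: walk_Cons)
    have "vstab G T p \<inter> vstab G T q \<subseteq> estab G T {x, y}"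
      unfolding estab_pair[OF e] using xs(2)[of x] xs(2)[of y] 3(4) by auto
    then have "{x, y} \<notin> edges_over K Q" using K by (auto simp: edges_over_def)
    then show ?case using 3 by (auto simp: walk_Cons)
  qed auto
  then show ?thesis using separated_iff[OF xs(1)] xs(1) by blast
qed

text \<open>This lets \<open>stabilizer_eq_act_iff\<close> compare the common stabilizer of two
  vertices with the stabilizer of an edge.\<close>

lemma gset_pairs: "gset G (verts T \<times> verts T) (\<lambda>g. map_prod (act T g) (act T g))"
  by unfold_locales (auto simp: V.closed V.act_one V.act_mult)

lemma stabilizer_pair:
  "stabilizer G (\<lambda>g. map_prod (act T g) (act T g)) (p, q) = vstab G T p \<inter> vstab G T q"
  by (auto simp: stabilizer_def vstab_def)

text \<open>Since the pair and its translate both have common stabilizer \<open>K\<close>, the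
  element \<open>g\<close> normalizes \<open>K\<close>. It therefore preserves
  \<open>edges_over K Q\<close> and maps walks to walks of equal parity.\<close>

lemma separated_edges_over_act:
  assumes g: "g \<in> carrier G" and p: "p \<in> verts T" and q: "q \<in> verts T"
    and K: "vstab G T p \<inter> vstab G T q = K" "vstab G T (act T g p) \<inter> vstab G T (act T g q) = K"
  shows "separated (edges_over K Q) (act T g p) (act T g q) \<longleftrightarrow> separated (edges_over K Q) p q"
proof -
  have *: "edge_act T g e \<in> edges_over K Q \<longleftrightarrow> e \<in> edges_over K Q" if e: "e \<in> edges T" for e
  proof -
    have "(p, q) \<in> verts T \<times> verts T" using p q by simp
    then have "estab G T (edge_act T g e) = K \<longleftrightarrow> estab G T e = K"
      using stabilizer_eq_act_iff[OF E.gset_axioms gset_pairs g e, of "(p, q)"] K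
      by (simp add: stabilizer_pair estab_def)
    then show ?thesis using e g by (simp add: edges_over_def E.closed E.orbit_act)
  qed
  obtain xs where xs: "walk (edges T) p xs q" using ex_walk[OF p q] by blast
  have "crossing_parity (edges_over K Q) (map (act T g) ys) \<longleftrightarrow> crossing_parity (edges_over K Q) ys"
    if "walk (edges T) r ys q" for r ys
    using that
  proof (induction ys arbitrary: r rule: induct_list012)
    case (3 x y zs)
    then show ?case using *[of "{x, y}"] by (auto simp: walk_Cons)
  qed auto
  then show ?thesis using separated_iff[OF walk_act[OF g xs]] separated_iff[OF xs] xs by blast
qed

text \<open>
  A set \<open>Q\<close> of orbits of edges with stabilizer \<open>K\<close> induces the relation "separated by an odd number
  of edges in \<open>edges_over K Q\<close>" on the vertices fixed by \<open>K\<close>, and it can be recovered from it. Its values on pairs whose common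
  stabilizer is larger than \<open>K\<close> vanish, so its pullback to the other tree is determined by its
  values on the edges of stabilizer \<open>K\<close> there, and these values only depend on the orbit of the edge.
\<close>

lemma card_edge_orbits_le:
  assumes T': "g_tree G T'"
    and f: "equivariant_bijection G (verts T') (act T') (verts T) (act T) f"
    and fin: "finite (orbits G (edges T) (edge_act T))" "finite (orbits G (edges T') (edge_act T'))"
  shows "card {oo \<in> orbits G (edges T) (edge_act T). K \<in> estab G T ` oo}
       \<le> card {oo \<in> orbits G (edges T') (edge_act T'). K \<in> estab G T' ` oo}" (is "card ?O \<le> card ?O'")
proof -
  interpret T': g_tree G T' by fact
  have f_closed: "f x \<in> verts T" if "x \<in> verts T'" for x
    using f that by (auto simp: equivariant_bijection_def bij_betw_def)
  have f_act: "f (act T' g x) = act T g (f x)" if "g \<in> carrier G" "x \<in> verts T'" for g x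
    using f that by (auto simp: equivariant_bijection_def)
  have f_surj: "\<exists>y\<in>verts T'. f y = x" if "x \<in> verts T" for x
    using f that by (metis equivariant_bijection_def bij_betw_def imageE)
  have f_vstab: "vstab G T (f x) = vstab G T' x" if "x \<in> verts T'" for x
    using equivariant_bijection_stabilizer[OF T'.V.gset_axioms V.gset_axioms f that]
    by (simp add: vstab_def)
  \<comment> \<open>The map \<open>f\<close> preserves stabilizers but need not preserve adjacency.
    What is pulled back is thus a relation on all pairs of vertices, not a set of edges.\<close>
  define c where "c Q p q \<longleftrightarrow> separated (edges_over K Q) (f p) (f q)" for Q p q
  define \<Phi> where "\<Phi> Q = {orbit G (edge_act T') {p, q} |p q.
    {p, q} \<in> edges T' \<and> estab G T' {p, q} = K \<and> c Q p q}" for Q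
  have c_trans: "c Q p r \<longleftrightarrow> c Q p q \<noteq> c Q q r"
    if "p \<in> verts T'" "q \<in> verts T'" "r \<in> verts T'" for Q p q r
    unfolding c_def using that f_closed separated_trans by blast
  \<comment> \<open>An element carrying one edge with stabilizer \<open>K\<close> to another
    normalizes \<open>K\<close>, so \<open>c\<close> takes the same value on both. Edges are
    unordered, whence the appeal to symmetry.\<close>
  have c_\<Phi>: "c Q p q \<longleftrightarrow> orbit G (edge_act T') {p, q} \<in> \<Phi> Q"
    if e: "{p, q} \<in> edges T'" "estab G T' {p, q} = K" for Q p q
  proof
    assume "orbit G (edge_act T') {p, q} \<in> \<Phi> Q"
    then obtain u w where u: "{u, w} \<in> edges T'" "estab G T' {u, w} = K" "c Q u w"
      "orbit G (edge_act T') {u, w} = orbit G (edge_act T') {p, q}" unfolding \<Phi>_def by auto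
    then obtain g where g: "g \<in> carrier G" "{p, q} = {act T' g u, act T' g w}"
      using T'.E.orbit_eq_iff[OF u(1) e(1)] by auto
    have v: "u \<in> verts T'" "w \<in> verts T'" "p \<in> verts T'" "q \<in> verts T'"
      using T'.edgeD u(1) e(1) by blast+
    have K1: "vstab G T (f u) \<inter> vstab G T (f w) = K"
      using u T'.estab_pair[OF u(1)] v f_vstab by simp
    have "vstab G T' (act T' g u) \<inter> vstab G T' (act T' g w) = K"
      using e T'.estab_pair[of "act T' g u" "act T' g w"] g(2) by simp
    then have K2: "vstab G T (act T g (f u)) \<inter> vstab G T (act T g (f w)) = K"
      using f_vstab f_act v g(1) T'.V.closed by metis
    have "c Q (act T' g u) (act T' g w)"
      using separated_edges_over_act[OF g(1) f_closed[OF v(1)] f_closed[OF v(2)] K1 K2] u(3) f_act v g(1)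
      by (simp add: c_def)
    then show "c Q p q"
      using g(2) v separated_sym f_closed unfolding c_def by (metis doubleton_eq_iff)
  qed (use e in \<open>auto simp: \<Phi>_def\<close>)
  \<comment> \<open>Along the geodesic in \<open>T'\<close> each edge has stabilizer
    \<open>K\<close>, and then \<open>c\<close> is read off from \<open>\<Phi>\<close>, or a larger
    one, and then \<open>c\<close> vanishes. Additivity sums up the steps.\<close>
  have c_eq: "c Q p q \<longleftrightarrow> c Q' p q"
    if "\<Phi> Q = \<Phi> Q'" and p: "p \<in> verts T'" "q \<in> verts T'" and K: "K \<subseteq> vstab G T' p \<inter> vstab G T' q" for Q Q' p q
  proof -
    obtain xs where xs: "walk (edges T') p xs q"
      "\<And>x. x \<in> set xs \<Longrightarrow> vstab G T' p \<inter> vstab G T' q \<subseteq> vstab G T' x"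
      using T'.ex_fixed_walk[OF p] by blast
    have "c Q r q \<longleftrightarrow> c Q' r q" if "walk (edges T') r ys q" "set ys \<subseteq> set xs" "r \<in> verts T'" for r ys
      using that
    proof (induction ys arbitrary: r rule: induct_list012)
      case (2 x)
      then show ?case using separated_refl f_closed by (auto simp: walk_single c_def)
    next
      case (3 x y zs)
      then have e: "{x, y} \<in> edges T'" "r = x" and w: "walk (edges T') y (y # zs) q"
        by (auto simp: walk_Cons)
      have v: "x \<in> verts T'" "y \<in> verts T'" using T'.edgeD e(1) by blast+
      have Kxy: "K \<subseteq> vstab G T' x \<inter> vstab G T' y" using K xs(2)[of x] xs(2)[of y] 3(4) by auto
      have "c Q x y \<longleftrightarrow> c Q' x y"
      proof (cases "K = vstab G T' x \<inter> vstab G T' y")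
        case True
        then show ?thesis
          using c_\<Phi>[OF e(1)] T'.estab_pair[OF e(1)] \<open>\<Phi> Q = \<Phi> Q'\<close> by simp
      next
        case False
        then have "K \<subset> vstab G T (f x) \<inter> vstab G T (f y)" using Kxy f_vstab v by blast
        then show ?thesis using not_separated_edges_over f_closed v by (simp add: c_def)
      qed
      moreover have "c Q y q \<longleftrightarrow> c Q' y q" using 3(2)[OF w _ v(2)] 3(4) by auto
      ultimately show ?case using c_trans[OF v p(2)] e(2) by blast
    qed auto
    then show ?thesis using xs(1) p by blast
  qed
  \<comment> \<open>The set \<open>Q\<close> is recovered by evaluating on the endpoints of edges of
    \<open>T\<close> with stabilizer \<open>K\<close>: they are separated exactly when the orbit of
    the edge lies in \<open>Q\<close>.\<close>
  have \<Phi>_subset: "Q \<subseteq> Q'" if Q: "Q \<subseteq> ?O" and eq: "\<Phi> Q = \<Phi> Q'" for Q Q'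
  proof
    fix oo assume oo: "oo \<in> Q"
    then obtain e where e: "e \<in> oo" "estab G T e = K" using Q by blast
    then have oo': "e \<in> edges T" "oo = orbit G (edge_act T) e" using E.in_orbits_eq[of oo e] Q oo by blast+
    then obtain p q where pq: "e = {p, q}" "p \<in> verts T" "q \<in> verts T" by (auto elim: edge_cases)
    obtain p' q' where p': "p' \<in> verts T'" "q' \<in> verts T'" "p = f p'" "q = f q'" using f_surj pq by metis
    have "K = vstab G T' p' \<inter> vstab G T' q'" using estab_pair[of p q] e oo' pq p' f_vstab by simp
    then have "c Q p' q' \<longleftrightarrow> c Q' p' q'" using c_eq[OF eq p'(1,2)] by blast
    then have "e \<in> edges_over K Q \<longleftrightarrow> e \<in> edges_over K Q'"
      using separated_edge[of p q] oo' pq p' by (simp add: c_def)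
    then show "oo \<in> Q'" using oo oo' e by (simp add: edges_over_def)
  qed
  have "inj_on \<Phi> (Pow ?O)"
    using \<Phi>_subset by (intro inj_onI subset_antisym) (auto simp only: Pow_iff)
  moreover have "\<Phi> ` Pow ?O \<subseteq> Pow ?O'"
  proof -
    have "orbit G (edge_act T') e \<in> ?O'" if "e \<in> edges T'" "estab G T' e = K" for e
      using that T'.E.orbit_self[OF that(1)] by (auto simp: orbits_def)
    then show ?thesis unfolding \<Phi>_def by blast
  qed
  moreover have fin': "finite ?O" "finite ?O'" using fin by simp_all
  \<comment> \<open>Only sets of orbits are mapped injectively. The bound on the orbits follows by
    comparing powers of two, for which finiteness is essential.\<close>
  ultimately have "card (Pow ?O) \<le> card (Pow ?O')" by (intro card_inj_on_le[of \<Phi>]) simp_all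
  then show ?thesis using fin' by (simp add: card_Pow)
qed

end

section \<open>Comparison of two reduced trees\<close>

lemma equivariant_bijection_inv:
  assumes X: "gset G X a" and f: "equivariant_bijection G X a Y b f"
  shows "equivariant_bijection G Y b X a (inv_into X f)"
proof -
  interpret gset G X a by fact
  have bij: "bij_betw f X Y" and eqv: "\<And>g x. g \<in> carrier G \<Longrightarrow> x \<in> X \<Longrightarrow> f (a g x) = b g (f x)"
    using f by (auto simp: equivariant_bijection_def)
  have "inv_into X f (b g y) = a g (inv_into X f y)" if "g \<in> carrier G" "y \<in> Y" for g y
  proof -
    let ?x = "inv_into X f y"
    have "?x \<in> X" "f ?x = y" using bij that(2) by (auto simp: bij_betw_def inv_into_into f_inv_into_f)
    then have "b g y = f (a g ?x)" "a g ?x \<in> X" using eqv closed that(1) by simp_all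
    then show ?thesis using bij by (simp add: bij_betw_def)
  qed
  then show ?thesis using bij_betw_inv_into[OF bij] by (simp add: equivariant_bijection_def)
qed

theorem corollary7p3:
  fixes G :: "('g, 'm) monoid_scheme" and D :: "('g, 'v) gtree set"
  assumes "group G" and "finitely_generated G"
    and "deformation_space G D" and "non_ascending G D"
  shows "\<forall>T\<^sub>1\<in>D. \<forall>T\<^sub>2\<in>D. reduced G T\<^sub>1 \<longrightarrow> reduced G T\<^sub>2 \<longrightarrow>
      vstab G T\<^sub>1 ` verts T\<^sub>1 = vstab G T\<^sub>2 ` verts T\<^sub>2 \<and>
      estab G T\<^sub>1 ` edges T\<^sub>1 = estab G T\<^sub>2 ` edges T\<^sub>2 \<and>
      (\<exists>\<psi>\<^sub>V. equivariant_bijection G (verts T\<^sub>1) (act T\<^sub>1) (verts T\<^sub>2) (act T\<^sub>2) \<psi>\<^sub>V) \<and>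
      (\<exists>\<psi>\<^sub>E. equivariant_bijection G (edges T\<^sub>1) (edge_act T\<^sub>1) (edges T\<^sub>2) (edge_act T\<^sub>2) \<psi>\<^sub>E)"
proof (intro ballI impI)
  fix T\<^sub>1 T\<^sub>2 assume T: "T\<^sub>1 \<in> D" "T\<^sub>2 \<in> D" and red: "reduced G T\<^sub>1" "reduced G T\<^sub>2"
  have "G_tree G T\<^sub>1" "G_tree G T\<^sub>2" and ell: "elliptic_subgroups G T\<^sub>1 = elliptic_subgroups G T\<^sub>2"
    using assms(3) T by (auto simp: deformation_space_def deformation_space_of_def)
  then have gt: "g_tree G T\<^sub>1" "g_tree G T\<^sub>2"
    using assms(1) by (simp_all add: g_tree_def g_tree_axioms_def)
  interpret T1: g_tree G T\<^sub>1 by (fact gt)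
  interpret T2: g_tree G T\<^sub>2 by (fact gt)
  have asc: "\<nexists>y. strict_ascending_loop G T\<^sub>1 y" "\<nexists>y. strict_ascending_loop G T\<^sub>2 y"
    using assms(4) T by (auto simp: non_ascending_def)
  obtain \<psi> where \<psi>: "equivariant_bijection G (verts T\<^sub>1) (act T\<^sub>1) (verts T\<^sub>2) (act T\<^sub>2) \<psi>"
    using T1.vertex_equivariant_bijection[OF gt(2) ell red asc] by blast
  note fin = T1.finite_edge_orbits[OF assms(2)] T2.finite_edge_orbits[OF assms(2)]
  have "\<exists>\<beta>. bij_betw \<beta> {oo \<in> orbits G (edges T\<^sub>1) (edge_act T\<^sub>1). K \<in> estab G T\<^sub>1 ` oo}
      {oo \<in> orbits G (edges T\<^sub>2) (edge_act T\<^sub>2). K \<in> estab G T\<^sub>2 ` oo}" for K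
  proof (rule finite_same_card_bij)
    show "card {oo \<in> orbits G (edges T\<^sub>1) (edge_act T\<^sub>1). K \<in> estab G T\<^sub>1 ` oo}
        = card {oo \<in> orbits G (edges T\<^sub>2) (edge_act T\<^sub>2). K \<in> estab G T\<^sub>2 ` oo}"
      \<comment> \<open>Relations are pulled back, so the bound for \<open>T\<^sub>1\<close> uses
        the inverse of \<open>\<psi>\<close> and the bound for \<open>T\<^sub>2\<close> uses
        \<open>\<psi>\<close> itself.\<close>
      using T1.card_edge_orbits_le[OF gt(2) equivariant_bijection_inv[OF T1.V.gset_axioms \<psi>] fin]
        T2.card_edge_orbits_le[OF gt(1) \<psi> fin(2,1)] by (rule order_antisym)
  qed (use fin in simp_all)
  then have "\<exists>\<psi>. equivariant_bijection G (edges T\<^sub>1) (edge_act T\<^sub>1) (edges T\<^sub>2) (edge_act T\<^sub>2) \<psi>"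
    by (intro equivariant_bijection_of_orbits T1.E.gset_axioms T2.E.gset_axioms)
      (simp add: estab_def[abs_def])
  then obtain \<psi>' where \<psi>': "equivariant_bijection G (edges T\<^sub>1) (edge_act T\<^sub>1) (edges T\<^sub>2) (edge_act T\<^sub>2) \<psi>'"
    by blast
  have "vstab G T\<^sub>1 ` verts T\<^sub>1 = vstab G T\<^sub>2 ` verts T\<^sub>2"
    using equivariant_bijection_stabilizers[OF T1.V.gset_axioms T2.V.gset_axioms \<psi>]
    by (simp add: vstab_def[abs_def])
  moreover have "estab G T\<^sub>1 ` edges T\<^sub>1 = estab G T\<^sub>2 ` edges T\<^sub>2"
    using equivariant_bijection_stabilizers[OF T1.E.gset_axioms T2.E.gset_axioms \<psi>']
    by (simp add: estab_def[abs_def])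
  ultimately show "vstab G T\<^sub>1 ` verts T\<^sub>1 = vstab G T\<^sub>2 ` verts T\<^sub>2 \<and>
      estab G T\<^sub>1 ` edges T\<^sub>1 = estab G T\<^sub>2 ` edges T\<^sub>2 \<and>
      (\<exists>\<psi>\<^sub>V. equivariant_bijection G (verts T\<^sub>1) (act T\<^sub>1) (verts T\<^sub>2) (act T\<^sub>2) \<psi>\<^sub>V) \<and>
      (\<exists>\<psi>\<^sub>E. equivariant_bijection G (edges T\<^sub>1) (edge_act T\<^sub>1) (edges T\<^sub>2) (edge_act T\<^sub>2) \<psi>\<^sub>E)"
    using \<psi> \<psi>' by blast
qed

end
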